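(* Let $n,p_0\ge 1$, let $V^{(0)}\in\mathbb{R}^{n\times p_0}$ be an initial reduced basis with entries $v^{(0)}_{lj}$, and let $(C,E)$ be a refinement tree on $\{1,\dots,n\}$ with nodes $\{1,\dots,m\}$ (as defined in the context); in particular, for every $l\in\{1,\dots,n\}$ there exists a node $i\in\{1,\dots,m\}$ with $E(i)=\{l\}$ and $C(i)=\emptyset$. Suppose that every element has a nonzero entry in one of the original reduced-basis vectors, i.e., for every $l\in\{1,\dots,n\}$ there exists $j\in\{1,\dots,p_0\}$ such that $v^{(0)}_{lj}\neq 0$. Then the completely split basis $V$ obtained from $V^{(0)}$ and $(C,E)$ yields a reduced-order model that is equivalent to the full-order model.
   Context: Notation: $\mathcal P(S)$ is the power set of $S$, and $\mathrm{range}(A)$ is the column space of a matrix $A$. Refinement tree: a finite rooted tree with node set $\{1,\dots,m\}$ and root $1$, given by a child function $C:\{1,\dots,m\}\to\mathcal P(\{1,\dots,m\})$ ($C(i)$ is the set of children of node $i$; $i$ is a leaf if $C(i)=\emptyset$) and an element function $E:\{1,\dots,m\}\to\mathcal P(\{1,\dots,n\})$, such that: (1) $E(1)=\{1,\dots,n\}$; (2) for every non-leaf node $i$, the sets $E(j)$, $j\in C(i)$, are pairwise disjoint and $\bigcup_{j\in C(i)}E(j)=E(i)$; (3) for every $l\in\{1,\dots,n\}$ there is a node $i$ with $E(i)=\{l\}$ and $C(i)=\emptyset$. Splitting: each basis vector $v$ is associated with a node $d$, with the entries of $v$ vanishing outside $E(d)$. Splitting a vector $v$ at a non-leaf node $d$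 replaces it by the vectors $v|_{E(k)}$, $k\in C(d)$, where $v|_{S}$ has the same entries as $v$ at indices in $S$ and zeros elsewhere; $v|_{E(k)}$ is associated with node $k$. Initially every column of $V^{(0)}$ is associated with the root node $1$. The completely split basis is the matrix $V$ obtained by splitting repeatedly until every vector is associated with a leaf; that is, its columns are (in some order) the vectors $v^{(0)}_j|_{E(d)}$ for all $j\in\{1,\dots,p_0\}$ and all leaves $d$, where $v^{(0)}_j$ is the $j$th column of $V^{(0)}$. Full-order and reduced-order models: for each iteration index $k$ and parameter $\mu$ there is a residual $r^k(\cdot\,;\mu):\mathbb{R}^n\to\mathbb{R}^n$, and $\bar x\in\mathbb{R}^n$ is a fixed reference state. The full-order model is the system $r^k(x;\mu)=0$ for $x\in\mathbb{R}^n$. The reduced-order model with basis $V\in\mathbb{R}^{n\times p}$ is the system $V^T r^k(\bar x+V\hat x;\mu)=0$ for $\hat x\in\mathbb{R}^p$, with associated approximate state $\bar x+V\hat x$. The reduced-order model with basis $V$ is called equivalent to the full-order model if $\mathrm{range}(V)=\mathbb{R}^n$ and, for all $k$ and $\mu$, a state $x\in\mathbb{R}^n$ satisfies $r^k(x;\mu)=0$ if and only if $x=\bar x+V\hat x$ for some solution $\hat x$ of the reduced-order model. *)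

theory Defs
  imports "HOL-Analysis.Analysis" "HOL-Library.Multiset" "HOL-Library.Disjoint_Sets"
begin

section \<open>Refinement trees\<close>

definition tree_edges :: "nat \<Rightarrow> (nat \<Rightarrow> nat set) \<Rightarrow> (nat \<times> nat) set" where
  "tree_edges m C = {(i, j). i \<in> {1..m} \<and> j \<in> C i}"

definition rooted_tree :: "nat \<Rightarrow> (nat \<Rightarrow> nat set) \<Rightarrow> bool" where
  "rooted_tree m C \<longleftrightarrow>
     1 \<le> m \<and>
     (\<forall>i\<in>{1..m}. C i \<subseteq> {1..m}) \<and>
     (\<forall>i\<in>{1..m}. 1 \<notin> C i) \<and>
     (\<forall>j\<in>{1..m}. j \<noteq> 1 \<longrightarrow> (\<exists>!i. i \<in> {1..m} \<and> j \<in> C i)) \<and>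
     (\<forall>j\<in>{1..m}. (1, j) \<in> (tree_edges m C)\<^sup>*)"

text \<open>The \<open>n\<close> elements are the members of the finite index type \<open>'n\<close>, so the set of all
  elements is \<open>UNIV\<close>. Disjointness refers to the family indexed by the children, not to the set of
  its values: two distinct children may carry the same element set only if it is empty.\<close>

definition refinement_tree :: "nat \<Rightarrow> (nat \<Rightarrow> nat set) \<Rightarrow> (nat \<Rightarrow> 'n::finite set) \<Rightarrow> bool" where
  "refinement_tree m C E \<longleftrightarrow>
     rooted_tree m C \<and>
     E 1 = UNIV \<and>
     (\<forall>i\<in>{1..m}. C i \<noteq> {} \<longrightarrow> disjoint_family_on E (C i) \<and> (\<Union>j\<in>C i. E j) = E i) \<and>
     (\<forall>l. \<exists>i\<in>{1..m}. E i = {l} \<and> C i = {})"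

section \<open>Splitting\<close>

definition restrict_vec :: "real^'n \<Rightarrow> 'n set \<Rightarrow> real^'n" where
  "restrict_vec v S = (\<chi> l. if l \<in> S then v $ l else 0)"

text \<open>A state of the splitting process is a multiset of basis vectors, each paired with its
  associated node. Multisets, since the order of the columns is irrelevant while repeated (for
  instance zero) columns are kept.\<close>

inductive split_step ::
  "(nat \<Rightarrow> nat set) \<Rightarrow> (nat \<Rightarrow> 'n set) \<Rightarrow>
   ((real^'n) \<times> nat) multiset \<Rightarrow> ((real^'n) \<times> nat) multiset \<Rightarrow> bool"
  for C E where
  "(v, d) \<in># M \<Longrightarrow> C d \<noteq> {} \<Longrightarrow>
     split_step C E M (M - {#(v, d)#} + {#(restrict_vec v (E k), k). k \<in># mset_set (C d)#})"

definition matrix_columns :: "real^'p^'n \<Rightarrow> (real^'n) multiset" where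
  "matrix_columns A = {#column j A. j \<in># mset_set UNIV#}"

definition initial_basis :: "real^'p0^'n \<Rightarrow> ((real^'n) \<times> nat) multiset" where
  "initial_basis V0 = {#(v, 1). v \<in># matrix_columns V0#}"

text \<open>The index type \<open>'p\<close> of the columns of \<open>V\<close> is not fixed in advance; equality of the column
  multisets forces it to have as many members as there are vectors in the final state.\<close>

definition completely_split_basis ::
  "(nat \<Rightarrow> nat set) \<Rightarrow> (nat \<Rightarrow> 'n set) \<Rightarrow> real^'p0^'n \<Rightarrow> real^'p^'n \<Rightarrow> bool" where
  "completely_split_basis C E V0 V \<longleftrightarrow>
     (\<exists>M. (split_step C E)\<^sup>*\<^sup>* (initial_basis V0) M \<and>
          (\<forall>(v, d)\<in>#M. C d = {}) \<and>
          matrix_columns V = image_mset fst M)"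

section \<open>Full-order and reduced-order models\<close>

definition fom_solution ::
  "('k \<Rightarrow> real^'n \<Rightarrow> 'mu \<Rightarrow> real^'n) \<Rightarrow> 'k \<Rightarrow> 'mu \<Rightarrow> real^'n \<Rightarrow> bool" where
  "fom_solution r k \<mu> x \<longleftrightarrow> r k x \<mu> = 0"

definition rom_solution ::
  "('k \<Rightarrow> real^'n \<Rightarrow> 'mu \<Rightarrow> real^'n) \<Rightarrow> real^'n \<Rightarrow> real^'p^'n \<Rightarrow> 'k \<Rightarrow> 'mu \<Rightarrow> real^'p \<Rightarrow> bool" where
  "rom_solution r xbar V k \<mu> xh \<longleftrightarrow> transpose V *v r k (xbar + V *v xh) \<mu> = 0"

definition rom_equivalent_to_fom ::
  "('k \<Rightarrow> real^'n \<Rightarrow> 'mu \<Rightarrow> real^'n) \<Rightarrow> real^'n \<Rightarrow> real^'p^'n \<Rightarrow> bool" where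
  "rom_equivalent_to_fom r xbar V \<longleftrightarrow>
     span (columns V) = UNIV \<and>
     (\<forall>k \<mu> x. fom_solution r k \<mu> x \<longleftrightarrow>
        (\<exists>xh. rom_solution r xbar V k \<mu> xh \<and> x = xbar + V *v xh))"

section \<open>Explicit description of the completely split basis\<close>

lemma tree_edge_parent_unique:
  assumes "rooted_tree m C" "(i, j) \<in> tree_edges m C" "(i', j) \<in> tree_edges m C"
  shows "i = i'"
proof -
  have "j \<in> {1..m}" "j \<noteq> 1" "i \<in> {1..m}" "i' \<in> {1..m}" "j \<in> C i" "j \<in> C i'"
    using assms unfolding rooted_tree_def tree_edges_def by blast+
  then show ?thesis
    using assms(1) unfolding rooted_tree_def by blast
qed

lemma tree_acyclic:
  assumes T: "rooted_tree m C"
  shows "(i, i) \<notin> (tree_edges m C)\<^sup>+"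
proof
  let ?r = "tree_edges m C"
  assume i: "(i, i) \<in> ?r\<^sup>+"
  then obtain w where "(i, w) \<in> ?r" by (meson tranclD)
  then have "i \<in> {1..m}" unfolding tree_edges_def by blast
  then have "(1, i) \<in> ?r\<^sup>*" using T unfolding rooted_tree_def by blast
  then have "(i, i) \<notin> ?r\<^sup>+"
  proof (induction rule: rtrancl_induct)
    case base
    show ?case
    proof
      assume "(1, 1) \<in> ?r\<^sup>+"
      then obtain z where "(z, 1) \<in> ?r" by (meson tranclD2)
      then show False using T unfolding rooted_tree_def tree_edges_def by blast
    qed
  next
    case (step y z)
    show ?case
    proof
      assume "(z, z) \<in> ?r\<^sup>+"
      then obtain u where "(z, u) \<in> ?r\<^sup>*" "(u, z) \<in> ?r" by (meson tranclD2)
      then have "(z, y) \<in> ?r\<^sup>*" using tree_edge_parent_unique[OF T] step(2) by blast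
      then have "(y, y) \<in> ?r\<^sup>+" using step(2) by (meson rtrancl_into_trancl2)
      then show False using step by blast
    qed
  qed
  then show False using i by blast
qed

lemma tree_ancestors_chain:
  assumes T: "rooted_tree m C"
    and "(a, x) \<in> (tree_edges m C)\<^sup>*" and "(b, x) \<in> (tree_edges m C)\<^sup>*"
  shows "(a, b) \<in> (tree_edges m C)\<^sup>* \<or> (b, a) \<in> (tree_edges m C)\<^sup>*"
  using assms(2,3)
proof (induction rule: rtrancl_induct)
  case base
  then show ?case by blast
next
  case (step y z)
  from step(4) show ?case
  proof (cases rule: rtranclE)
    case base
    then show ?thesis using step(1,2) by (meson rtrancl.rtrancl_into_rtrancl)
  next
    case (step w)
    then show ?thesis using tree_edge_parent_unique[OF T] \<open>(y, z) \<in> _\<close> \<open>(b, y) \<in> _ \<Longrightarrow> _\<close> by blast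
  qed
qed

definition descendants :: "nat \<Rightarrow> (nat \<Rightarrow> nat set) \<Rightarrow> nat \<Rightarrow> nat set" where
  "descendants m C d = (tree_edges m C)\<^sup>* `` {d}"

lemma descendants_subset:
  assumes "rooted_tree m C" "d \<in> {1..m}"
  shows "descendants m C d \<subseteq> {1..m}"
proof -
  have "x \<in> {1..m}" if "(d, x) \<in> (tree_edges m C)\<^sup>*" for x
    using that
  proof (induction rule: rtrancl_induct)
    case (step y z)
    then show ?case using assms(1) unfolding rooted_tree_def tree_edges_def by blast
  qed (rule assms(2))
  then show ?thesis unfolding descendants_def by blast
qed

lemma descendants_unfold:
  assumes "d \<in> {1..m}"
  shows "descendants m C d = insert d (\<Union>k\<in>C d. descendants m C k)"
proof -
  have "x = d \<or> (\<exists>k\<in>C d. (k, x) \<in> (tree_edges m C)\<^sup>*)" if "(d, x) \<in> (tree_edges m C)\<^sup>*" for x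
    using that by (cases rule: converse_rtranclE) (auto simp: tree_edges_def)
  moreover have "(d, k) \<in> tree_edges m C" if "k \<in> C d" for k
    using that assms unfolding tree_edges_def by blast
  ultimately show ?thesis
    unfolding descendants_def by (auto intro: converse_rtrancl_into_rtrancl)
qed

lemma descendants_children:
  assumes T: "rooted_tree m C" and d: "d \<in> {1..m}"
  shows "disjoint_family_on (descendants m C) (C d)" and "d \<notin> (\<Union>k\<in>C d. descendants m C k)"
proof -
  let ?r = "tree_edges m C"
  have e: "(d, k) \<in> ?r" if "k \<in> C d" for k
    using that d unfolding tree_edges_def by blast
  have *: "(k, d) \<notin> ?r\<^sup>*" if "k \<in> C d" for k
    using e[OF that] tree_acyclic[OF T, of d] by (meson rtrancl_into_trancl2)
  then show "d \<notin> (\<Union>k\<in>C d. descendants m C k)" unfolding descendants_def by blast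
  have **: "k = k'" if "(k, k') \<in> ?r\<^sup>*" "k \<in> C d" "k' \<in> C d" for k k'
    using that(1)
  proof (cases rule: rtranclE)
    case (step w)
    then show ?thesis using tree_edge_parent_unique[OF T step(2) e[OF that(3)]] step(1) *[OF that(2)] by simp
  qed
  show "disjoint_family_on (descendants m C) (C d)"
    unfolding disjoint_family_on_def
  proof (intro ballI impI)
    fix k k' assume k: "k \<in> C d" "k' \<in> C d" "k \<noteq> k'"
    have False if "(k, x) \<in> ?r\<^sup>*" "(k', x) \<in> ?r\<^sup>*" for x
      using tree_ancestors_chain[OF T that] **[OF _ k(1,2)] **[OF _ k(2,1)] k(3) by metis
    then show "descendants m C k \<inter> descendants m C k' = {}"
      unfolding descendants_def by blast
  qed
qed

definition leaves_below :: "nat \<Rightarrow> (nat \<Rightarrow> nat set) \<Rightarrow> nat \<Rightarrow> nat set" where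
  "leaves_below m C d = {l \<in> descendants m C d. C l = {}}"

definition leaf_pieces ::
  "nat \<Rightarrow> (nat \<Rightarrow> nat set) \<Rightarrow> (nat \<Rightarrow> 'n set) \<Rightarrow> (real^'n) \<times> nat \<Rightarrow> (real^'n) multiset" where
  "leaf_pieces m C E = (\<lambda>(v, d). {#restrict_vec v (E l). l \<in># mset_set (leaves_below m C d)#})"

lemma finite_children:
  assumes "rooted_tree m C" "d \<in> {1..m}" shows "finite (C d)"
proof -
  have "C d \<subseteq> {1..m}" using assms unfolding rooted_tree_def by blast
  then show ?thesis by (rule finite_subset) simp
qed

lemma element_subset_descendant:
  assumes R: "refinement_tree m C E" and "(d, x) \<in> (tree_edges m C)\<^sup>*"
  shows "E x \<subseteq> E d"
  using assms(2)
proof (induction rule: rtrancl_induct)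
  case (step y z)
  then have "E z \<subseteq> E y" using R unfolding refinement_tree_def tree_edges_def by blast
  then show ?case using step(3) by (rule order_trans)
qed simp

lemma mset_set_UN_disjoint:
  assumes "finite I" "\<And>i. i \<in> I \<Longrightarrow> finite (A i)" "disjoint_family_on A I"
  shows "mset_set (\<Union>i\<in>I. A i) = (\<Sum>i\<in>I. mset_set (A i))"
  using assms
proof (induction I rule: finite_induct)
  case (insert x F)
  have "A x \<inter> (\<Union>i\<in>F. A i) = {}" "disjoint_family_on A F"
    using insert(2,5) unfolding disjoint_family_on_def by auto
  then show ?case using insert by (simp add: mset_set_Union)
qed simp

lemma image_mset_sum: "image_mset f (\<Sum>i\<in>I. A i) = (\<Sum>i\<in>I. image_mset f (A i))"
  by (induction I rule: infinite_finite_induct) auto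

lemma leaf_pieces_split:
  fixes E :: "nat \<Rightarrow> 'n::finite set"
  assumes R: "refinement_tree m C E" and d: "d \<in> {1..m}" and ne: "C d \<noteq> {}"
  shows "leaf_pieces m C E (v, d) = (\<Sum>k\<in>C d. leaf_pieces m C E (restrict_vec v (E k), k))"
proof -
  have T: "rooted_tree m C" using R unfolding refinement_tree_def by blast
  have f: "finite (leaves_below m C k)" if "k \<in> C d" for k
  proof -
    have "k \<in> {1..m}" using that d T unfolding rooted_tree_def by blast
    then show ?thesis
      using descendants_subset[OF T] unfolding leaves_below_def
      by (metis (no_types, lifting) finite_atLeastAtMost finite_subset mem_Collect_eq subsetI)
  qed
  have U: "leaves_below m C d = (\<Union>k\<in>C d. leaves_below m C k)"
    unfolding leaves_below_def descendants_unfold[OF d, of C] using ne by auto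
  have D: "disjoint_family_on (leaves_below m C) (C d)"
    using descendants_children(1)[OF T d] unfolding disjoint_family_on_def leaves_below_def by blast
  have "leaf_pieces m C E (v, d) =
      (\<Sum>k\<in>C d. {#restrict_vec v (E l). l \<in># mset_set (leaves_below m C k)#})"
    using mset_set_UN_disjoint[of "C d" "leaves_below m C"] finite_children[OF T d] f D
    by (simp add: leaf_pieces_def U image_mset_sum)
  also have "\<dots> = (\<Sum>k\<in>C d. leaf_pieces m C E (restrict_vec v (E k), k))"
  proof (rule sum.cong[OF refl])
    fix k assume k: "k \<in> C d"
    have "restrict_vec v (E l) = restrict_vec (restrict_vec v (E k)) (E l)"
      if "l \<in> leaves_below m C k" for l
      using element_subset_descendant[OF R, of k l] that
      unfolding leaves_below_def descendants_def restrict_vec_def by (auto simp: vec_eq_iff)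
    then show "{#restrict_vec v (E l). l \<in># mset_set (leaves_below m C k)#} =
        leaf_pieces m C E (restrict_vec v (E k), k)"
      unfolding leaf_pieces_def using f[OF k] by (auto intro: image_mset_cong)
  qed
  finally show ?thesis .
qed

definition valid_state :: "nat \<Rightarrow> (nat \<Rightarrow> 'n set) \<Rightarrow> ((real^'n) \<times> nat) multiset \<Rightarrow> bool" where
  "valid_state m E M \<longleftrightarrow> (\<forall>(v, d)\<in>#M. d \<in> {1..m} \<and> restrict_vec v (E d) = v)"

lemma split_step_invariant:
  fixes E :: "nat \<Rightarrow> 'n::finite set"
  assumes R: "refinement_tree m C E" and "valid_state m E M" and "split_step C E M N"
  shows "valid_state m E N"
    and "(\<Sum>x\<in>#N. leaf_pieces m C E x) = (\<Sum>x\<in>#M. leaf_pieces m C E x)"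
    and "(\<Sum>(v, d)\<in>#N. card (descendants m C d)) < (\<Sum>(v, d)\<in>#M. card (descendants m C d))"
proof -
  have T: "rooted_tree m C" using R unfolding refinement_tree_def by blast
  from assms(3) obtain v d where vd: "(v, d) \<in># M" "C d \<noteq> {}" and
    N: "N = M - {#(v, d)#} + {#(restrict_vec v (E k), k). k \<in># mset_set (C d)#}"
    by (cases rule: split_step.cases) blast
  from vd(1) obtain M' where M: "M = add_mset (v, d) M'" by (meson mset_add)
  have d: "d \<in> {1..m}" using vd(1) assms(2) unfolding valid_state_def by blast
  have fin: "finite (C d)" by (rule finite_children[OF T d])
  have ch: "k \<in> {1..m}" if "k \<in> C d" for k using that d T unfolding rooted_tree_def by blast
  have N': "N = M' + {#(restrict_vec v (E k), k). k \<in># mset_set (C d)#}" using N M by simp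
  have "restrict_vec (restrict_vec v S) S = restrict_vec v S" for S
    by (simp add: restrict_vec_def vec_eq_iff)
  then show "valid_state m E N"
    using assms(2) ch fin unfolding valid_state_def N' M by auto
  have "(\<Sum>x\<in>#{#(restrict_vec v (E k), k). k \<in># mset_set (C d)#}. leaf_pieces m C E x) =
      leaf_pieces m C E (v, d)"
    unfolding leaf_pieces_split[OF R d vd(2)]
    by (simp add: sum_unfold_sum_mset image_mset.compositionality comp_def)
  then show "(\<Sum>x\<in>#N. leaf_pieces m C E x) = (\<Sum>x\<in>#M. leaf_pieces m C E x)"
    unfolding N' M by (simp add: add.commute)
  have fd: "finite (descendants m C k)" if "k \<in> {1..m}" for k
    by (rule finite_subset[OF descendants_subset[OF T that]]) simp
  have "(\<Sum>(v, d)\<in>#{#(restrict_vec v (E k), k). k \<in># mset_set (C d)#}. card (descendants m C d)) =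
      (\<Sum>k\<in>C d. card (descendants m C k))"
    by (simp add: sum_unfold_sum_mset image_mset.compositionality comp_def)
  also have "\<dots> = card (\<Union>k\<in>C d. descendants m C k)"
  proof (rule card_UN_disjoint[symmetric])
    show "\<forall>i\<in>C d. \<forall>j\<in>C d. i \<noteq> j \<longrightarrow> descendants m C i \<inter> descendants m C j = {}"
      using descendants_children(1)[OF T d] unfolding disjoint_family_on_def by blast
  qed (use fin fd ch in blast)+
  also have "\<dots> < card (descendants m C d)"
    by (rule psubset_card_mono[OF fd[OF d]])
      (use descendants_unfold[OF d, of C] descendants_children(2)[OF T d] in blast)
  finally show "(\<Sum>(v, d)\<in>#N. card (descendants m C d)) < (\<Sum>(v, d)\<in>#M. card (descendants m C d))"
    unfolding N' M image_mset_union sum_mset.union image_mset_add_mset sum_mset.add_mset prod.case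
    by linarith
qed

lemma split_steps_invariant:
  fixes E :: "nat \<Rightarrow> 'n::finite set"
  assumes R: "refinement_tree m C E" and "valid_state m E M" and "(split_step C E)\<^sup>*\<^sup>* M N"
  shows "valid_state m E N \<and> (\<Sum>x\<in>#N. leaf_pieces m C E x) = (\<Sum>x\<in>#M. leaf_pieces m C E x)"
  using assms(3)
proof (induction rule: rtranclp_induct)
  case (step y z)
  from step(3) have y: "valid_state m E y"
    and eq: "(\<Sum>x\<in>#y. leaf_pieces m C E x) = (\<Sum>x\<in>#M. leaf_pieces m C E x)"
    by blast+
  show ?case
    using split_step_invariant(1)[OF R y step(2)]
      trans[OF split_step_invariant(2)[OF R y step(2)] eq] by (rule conjI)
qed (use assms(2) in simp)

lemma splitting_terminates:
  fixes E :: "nat \<Rightarrow> 'n::finite set"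
  assumes R: "refinement_tree m C E" and "valid_state m E M"
  shows "\<exists>N. (split_step C E)\<^sup>*\<^sup>* M N \<and> (\<forall>(v, d)\<in>#N. C d = {})"
  using assms(2)
proof (induction "\<Sum>(v, d)\<in>#M. card (descendants m C d)" arbitrary: M rule: less_induct)
  case less
  show ?case
  proof (cases "\<forall>(v, d)\<in>#M. C d = {}")
    case False
    then obtain v d where "(v, d) \<in># M" "C d \<noteq> {}" by auto
    then obtain N where N: "split_step C E M N" using split_step.intros[of v d M C E] by metis
    from less(1)[OF split_step_invariant(3)[OF R less(2) N] split_step_invariant(1)[OF R less(2) N]]
    obtain N' where "(split_step C E)\<^sup>*\<^sup>* N N'" "\<forall>(v, d)\<in>#N'. C d = {}" by (elim exE conjE)
    then show ?thesis using converse_rtranclp_into_rtranclp[of "split_step C E", OF N] by (intro exI conjI)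
  qed (blast intro: rtranclp.rtrancl_refl)
qed

lemma leaf_pieces_final:
  assumes "valid_state m E N" "\<forall>(v, d)\<in>#N. C d = {}"
  shows "(\<Sum>x\<in>#N. leaf_pieces m C E x) = image_mset fst N"
  using assms
proof (induction N)
  case (add x N)
  obtain v d where x: "x = (v, d)" by force
  have d: "d \<in> {1..m}" "restrict_vec v (E d) = v" "C d = {}"
    using add(2,3) unfolding x valid_state_def by auto
  then have "leaves_below m C d = {d}"
    using descendants_unfold[OF d(1), of C] unfolding leaves_below_def by auto
  then have "leaf_pieces m C E x = {#v#}" unfolding leaf_pieces_def x using d by simp
  then show ?case using add x unfolding valid_state_def by simp
qed simp

text \<open>The splitting process always terminates and its outcome does not depend on the order of the
  splits: up to the order of the columns it consists of the restrictions of all original columns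
  to the element sets of all leaves.\<close>

lemma completely_split_basis_iff:
  fixes E :: "nat \<Rightarrow> 'n::finite set" and V0 :: "real^'p0^'n" and V :: "real^'p^'n"
  assumes R: "refinement_tree m C E"
  shows "completely_split_basis C E V0 V \<longleftrightarrow>
    matrix_columns V =
      {#restrict_vec (column j V0) (E d).
          (j, d) \<in># mset_set (UNIV \<times> {d \<in> {1..m}. C d = {}})#}"
proof -
  have T: "rooted_tree m C" using R unfolding refinement_tree_def by blast
  have one: "1 \<in> {1..m}" using T unfolding rooted_tree_def by auto
  let ?L = "{d \<in> {1..m}. C d = {}}"
  let ?R = "{#restrict_vec (column j V0) (E d). (j, d) \<in># mset_set (UNIV \<times> ?L)#}"
  have "descendants m C 1 = {1..m}"
    using descendants_subset[OF T one] T unfolding rooted_tree_def descendants_def by blast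
  then have L1: "leaves_below m C 1 = ?L" unfolding leaves_below_def by simp
  have v0: "valid_state m E (initial_basis V0)"
    using R one unfolding valid_state_def initial_basis_def refinement_tree_def restrict_vec_def
    by (auto simp: vec_eq_iff)
  have "(\<Sum>x\<in>#initial_basis V0. leaf_pieces m C E x) =
      (\<Sum>j\<in>UNIV. {#restrict_vec (column j V0) (E l). l \<in># mset_set ?L#})"
    unfolding initial_basis_def matrix_columns_def leaf_pieces_def sum_unfold_sum_mset
    by (simp add: image_mset.compositionality comp_def L1[unfolded One_nat_def])
  also have "\<dots> = ?R"
  proof -
    have fL: "finite ?L" by simp
    have "(\<Sum>j\<in>J. {#restrict_vec (column j V0) (E l). l \<in># mset_set ?L#}) =
        {#restrict_vec (column j V0) (E d). (j, d) \<in># mset_set (J \<times> ?L)#}" if "finite J" for J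
      using that
    proof (induction J rule: finite_induct)
      case (insert j J)
      have eq: "insert j J \<times> ?L = (Pair j) ` ?L \<union> J \<times> ?L" by blast
      have "mset_set (insert j J \<times> ?L) = image_mset (Pair j) (mset_set ?L) + mset_set (J \<times> ?L)"
        unfolding eq using insert fL
        by (subst mset_set_Union) (auto simp: image_mset_mset_set inj_on_def)
      then show ?case using insert by (simp add: image_mset.compositionality comp_def)
    qed simp
    then show ?thesis by simp
  qed
  finally have init: "(\<Sum>x\<in>#initial_basis V0. leaf_pieces m C E x) = ?R" .
  have fin: "image_mset fst N = ?R"
    if "(split_step C E)\<^sup>*\<^sup>* (initial_basis V0) N" "\<forall>(v, d)\<in>#N. C d = {}" for N
  proof -
    note inv = split_steps_invariant[OF R v0 that(1)]
    show ?thesis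
      using leaf_pieces_final[OF conjunct1[OF inv] that(2)] conjunct2[OF inv] init by (rule trans[OF trans[OF sym]])
  qed
  obtain N where "(split_step C E)\<^sup>*\<^sup>* (initial_basis V0) N" "\<forall>(v, d)\<in>#N. C d = {}"
    using splitting_terminates[OF R v0] by (elim exE conjE)
  note N = this fin[OF this]
  show ?thesis
    unfolding completely_split_basis_def
  proof (intro iffI)
    assume "matrix_columns V = ?R"
    with N show "\<exists>M. (split_step C E)\<^sup>*\<^sup>* (initial_basis V0) M \<and> (\<forall>(v, d)\<in>#M. C d = {}) \<and>
      matrix_columns V = image_mset fst M"
      by (intro exI[of _ N] conjI) simp_all
  qed (elim exE conjE, simp only: fin)
qed

end

theory Submission
  imports Defs
begin

text \<open>If \<open>l\<close> is the only element of a leaf, restricting a column with a nonzero \<open>l\<close>-th entry to that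
  leaf yields a nonzero multiple of the \<open>l\<close>-th unit vector. Hence \<open>V\<close> has full row rank, i.e. a
  right inverse, whose transpose is a left inverse of \<open>V\<^sup>T\<close>; so every state is of the form
  \<open>xbar + V xh\<close>, and projecting the residual with \<open>V\<^sup>T\<close> loses nothing.\<close>

lemma restrict_vec_singleton: "restrict_vec v {l} = v $ l *\<^sub>R axis l 1"
  by (simp add: restrict_vec_def vec_eq_iff axis_def)

text \<open>A span ignores multiplicities, so the multiset produced by splitting may be reduced to
  its underlying set.\<close>

lemma columns_eq_set_mset: "columns A = set_mset (matrix_columns A)"
  by (auto simp: columns_def matrix_columns_def)

lemma span_columns_completely_split_basis:
  fixes V0 :: "real^'p0^'n" and V :: "real^'p^'n"
  assumes R: "refinement_tree m C E"
    and nz: "\<forall>l. \<exists>j. V0 $ l $ j \<noteq> 0"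
    and V: "completely_split_basis C E V0 V"
  shows "span (columns V) = UNIV"
proof -
  have "axis l 1 \<in> span (columns V)" for l
  proof -
    obtain i where i: "i \<in> {1..m}" "E i = {l}" "C i = {}"
      using R unfolding refinement_tree_def by blast
    obtain j where j: "V0 $ l $ j \<noteq> 0"
      using nz by blast
    \<comment> \<open>The explicit description of the split basis exhibits the wanted column at the
      index pair \<open>(j, i)\<close>, without following individual splits.\<close>
    have "columns V =
        (\<lambda>(j, d). restrict_vec (column j V0) (E d)) ` (UNIV \<times> {d \<in> {1..m}. C d = {}})"
      using V unfolding completely_split_basis_iff[OF R] columns_eq_set_mset by simp
    then have "restrict_vec (column j V0) (E i) \<in> columns V"
      using i by (auto intro!: image_eqI[of _ _ "(j, i)"])
    then have "V0 $ l $ j *\<^sub>R axis l 1 \<in> span (columns V)"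
      by (simp add: i(2) restrict_vec_singleton column_def span_base)
    from span_scale[OF this, of "inverse (V0 $ l $ j)"] show ?thesis
      using j by simp
  qed
  then have "Basis \<subseteq> span (columns V)"
    by (auto simp: Basis_vec_def)
  then show ?thesis
    using span_mono[of Basis "span (columns V)"] by (simp add: span_span top.extremum_unique)
qed

lemma rom_equivalent_to_fom_if_span_columns:
  fixes V :: "real^'p^'n"
  assumes S: "span (columns V) = UNIV"
  shows "rom_equivalent_to_fom r xbar V"
proof -
  \<comment> \<open>\<open>span_vec_eq\<close> identifies the span over field scalars with the real
    one.\<close>
  obtain B :: "real^'n^'p" where B: "V ** B = mat 1"
    using S matrix_right_invertible_span_columns[of V] by (auto simp: span_vec_eq)
  have "transpose B ** transpose V = mat 1"
    using B by (metis matrix_transpose_mul transpose_mat)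
  then have inj: "y = 0" if "transpose V *v y = 0" for y
    using that by (metis matrix_vector_mul_assoc matrix_vector_mul_lid matrix_vector_mult_0_right)
  have surj: "x = xbar + V *v (B *v (x - xbar))" for x
    by (simp add: matrix_vector_mul_assoc B)
  \<comment> \<open>Forward, the witness is \<open>B *v (x - xbar)\<close> and a zero residual
    projects to zero; backward, \<open>inj\<close> is applied to the residual at
    \<open>x\<close>.\<close>
  have "fom_solution r k \<mu> x \<longleftrightarrow> (\<exists>xh. rom_solution r xbar V k \<mu> xh \<and> x = xbar + V *v xh)" for k \<mu> x
    unfolding fom_solution_def rom_solution_def
    using inj surj[of x] by (metis matrix_vector_mult_0_right)
  then show ?thesis
    using S unfolding rom_equivalent_to_fom_def by blast
qed

theorem theorem2:
  fixes V0 :: "real^'p0^'n"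
    and V :: "real^'p^'n"
    and m :: nat
    and C :: "nat \<Rightarrow> nat set"
    and E :: "nat \<Rightarrow> 'n set"
    and r :: "'k \<Rightarrow> real^'n \<Rightarrow> 'mu \<Rightarrow> real^'n"
    and xbar :: "real^'n"
  assumes "refinement_tree m C E"
    and "\<forall>l. \<exists>j. V0 $ l $ j \<noteq> 0"
    and "completely_split_basis C E V0 V"
  shows "rom_equivalent_to_fom r xbar V"
  by (rule rom_equivalent_to_fom_if_span_columns[OF span_columns_completely_split_basis[OF assms]])

end
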